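(* For every $n\geqslant 4$, regard the Cayley–Dickson algebra $\mathbb{A}_n$ as a Hilbert left $\mathbb{O}$-module, with left $\mathbb{O}$-multiplication given by the product of $\mathbb{A}_n$ and $\mathbb{O}$-inner product $\langle s,w\rangle_n:=\pi_{\mathbb{O}}(s\overline{w})$. Then $$S:=\{e_{8i}\mid i=0,\dots,2^{n-3}-1\}$$ is a weak associative orthonormal basis of $\mathbb{A}_n$, and every $x\in\mathbb{A}_n$ satisfies $$x=\sum_{i=0}^{2^{n-3}-1}\pi_{\mathbb{O}}(x\overline{e_{8i}})\,e_{8i}.$$
   Context: $\mathbb{O}$ is the real algebra of octonions with its real basis $e_0=1,e_1,\dots,e_7$, where $e_ie_j=\epsilon_{ijk}e_k-\delta_{ij}$ for $1\le i,j\le 7$ with $\epsilon$ completely skew-symmetric and equal to $1$ for $ijk=123,145,176,246,257,347,365$; $\operatorname{Re}x=\tfrac12(x+\overline{x})$; and $\mathbb{A}_3=\mathbb{O}$. For $n\ge 4$ the Cayley–Dickson algebra $\mathbb{A}_n$ is defined inductively: its elements are written uniquely as $a+be_{2^{n-1}}$ with $a,b\in\mathbb{A}_{n-1}$, conjugation is $\overline{a+be_{2^{n-1}}}=\overline{a}-be_{2^{n-1}}$, and multiplication is $$(a+be_{2^{n-1}})(c+de_{2^{n-1}})=(ac-\overline{d}b)+(da+b\overline{c})e_{2^{n-1}}.$$ $\mathbb{A}_n$ has canonical real basis $e_0,\dots,e_{2^n-1}$ where $e_{2^{n-1}+j}:=e_je_{2^{n-1}}$ for $1\le j\le 2^{n-1}-1$,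 and $\mathbb{O}\subset\mathbb{A}_n$ is the span of $e_0,\dots,e_7$. $\pi_{\mathbb{O}}:\mathbb{A}_n\to\mathbb{O}$ is the projection onto $\mathbb{O}$ killing $e_8,\dots,e_{2^n-1}$. A left $\mathbb{O}$-module is a real vector space $M$ with an $\mathbb{R}$-linear map $L:\mathbb{O}\to\operatorname{End}_{\mathbb{R}}(M)$, written $px:=L_p(x)$, such that $1x=x$ and $p(px)=p^2x$ for all $p\in\mathbb{O}$, $x\in M$. A Hilbert left $\mathbb{O}$-module is a left $\mathbb{O}$-module $H$ with an $\mathbb{R}$-bilinear map $\langle\cdot,\cdot\rangle:H\times H\to\mathbb{O}$ such that for all $u,v\in H$, $p\in\mathbb{O}$: (1) $\operatorname{Re}(\langle pu,v\rangle-p\langle u,v\rangle)=0$; (2) $\langle u,v\rangle=\overline{\langle v,u\rangle}$; (3) $\langle u,u\rangle\in[0,\infty)$, and $\langle u,u\rangle=0$ iff $u=0$; and $H$ is complete for the norm $\|u\|=\sqrt{\langle u,u\rangle}$. ($\mathbb{A}_n$ with the data above is such a module.) The second associator is $[p,u,v]:=\langle pu,v\rangle-p\langle u,v\rangle$. A subset $S=\{x_\alpha\}_{\alpha\in\Lambda}\subseteq H$ is an orthonormal system if $\langle x_\alpha,x_\beta\rangle=\delta_{\alpha\beta}$ for all $\alpha,\beta$; it is an orthonormal basis if it is an orthonormal system not properly contained in any other orthonormal system. An orthonormal basis $S$ is weak associative if $[p,x_\alpha,x_\beta]=0$ for all $p\in\mathbb{O}$ and all $\alpha,\beta\in\Lambda$.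 *)

theory Defs
  imports Complex_Main "HOL-Library.Function_Algebras"
begin

section \<open>Coordinate vectors\<close>

text \<open>
  All the algebras are realised inside the space of real sequences: the algebra of level \<open>n\<close>
  consists of the sequences vanishing from index \<open>2 ^ n\<close> on, the \<open>i\<close>-th entry being the
  coordinate at the basis vector \<open>e\<^sub>i\<close>. The inclusions between the levels, in particular that of
  the octonions, are then literal inclusions of sets. Addition, zero and scalars are pointwise; the
  pointwise multiplication and \<open>1\<close> of functions play no role below.
\<close>

instantiation "fun" :: (type, real_vector) real_vector
begin

definition scaleR_fun :: "real \<Rightarrow> ('a \<Rightarrow> 'b) \<Rightarrow> 'a \<Rightarrow> 'b" where
  "scaleR_fun r f = (\<lambda>x. r *\<^sub>R f x)"

instance
  by standard (auto simp: scaleR_fun_def fun_eq_iff scaleR_add_right scaleR_add_left)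

end

type_synonym cdvec = "nat \<Rightarrow> real"

definition cd_carrier :: "nat \<Rightarrow> cdvec set" where
  "cd_carrier n = {x. \<forall>i \<ge> 2 ^ n. x i = 0}"

abbreviation octonions :: "cdvec set" where
  "octonions \<equiv> cd_carrier 3"

definition cd_basis :: "nat \<Rightarrow> cdvec" where
  "cd_basis i = (\<lambda>j. if j = i then 1 else 0)"


section \<open>Octonions\<close>

definition oct_triples :: "(nat \<times> nat \<times> nat) set" where
  "oct_triples = {(1,2,3), (1,4,5), (1,7,6), (2,4,6), (2,5,7), (3,4,7), (3,6,5)}"

definition oct_eps :: "nat \<Rightarrow> nat \<Rightarrow> nat \<Rightarrow> real" where
  "oct_eps i j k =
     (if (i,j,k) \<in> oct_triples \<or> (j,k,i) \<in> oct_triples \<or> (k,i,j) \<in> oct_triples then 1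
      else if (j,i,k) \<in> oct_triples \<or> (i,k,j) \<in> oct_triples \<or> (k,j,i) \<in> oct_triples then - 1
      else 0)"

definition oct_basis_mult :: "nat \<Rightarrow> nat \<Rightarrow> cdvec" where
  "oct_basis_mult i j =
     (if i = 0 then cd_basis j
      else if j = 0 then cd_basis i
      else (\<Sum>k = 1..7. oct_eps i j k *\<^sub>R cd_basis k) - (if i = j then 1 else 0) *\<^sub>R cd_basis 0)"

definition oct_mult :: "cdvec \<Rightarrow> cdvec \<Rightarrow> cdvec" where
  "oct_mult x y = (\<Sum>i<8. \<Sum>j<8. (x i * y j) *\<^sub>R oct_basis_mult i j)"

definition oct_conj :: "cdvec \<Rightarrow> cdvec" where
  "oct_conj x = x 0 *\<^sub>R cd_basis 0 - (\<Sum>i = 1..7. x i *\<^sub>R cd_basis i)"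

text \<open>The real part is kept as an octonion, that is, a real multiple of \<open>cd_basis 0\<close>.\<close>

definition oct_Re :: "cdvec \<Rightarrow> cdvec" where
  "oct_Re x = (1/2) *\<^sub>R (x + oct_conj x)"

definition proj_oct :: "cdvec \<Rightarrow> cdvec" where
  "proj_oct x = (\<lambda>i. if i < 8 then x i else 0)"


section \<open>Cayley--Dickson algebras\<close>

text \<open>
  \<open>cd_join n a b\<close> is the element \<open>a + b e\<^bsub>2^(n-1)\<^esub>\<close> of level \<open>n\<close> (see \<open>cd_join_eq\<close> below), and
  \<open>cd_fst n x\<close>, \<open>cd_snd n x\<close> are the components \<open>a\<close>, \<open>b\<close> of \<open>x\<close>.
\<close>

definition cd_join :: "nat \<Rightarrow> cdvec \<Rightarrow> cdvec \<Rightarrow> cdvec" where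
  "cd_join n a b =
     (\<lambda>i. if i < 2 ^ (n - 1) then a i else if i < 2 ^ n then b (i - 2 ^ (n - 1)) else 0)"

definition cd_fst :: "nat \<Rightarrow> cdvec \<Rightarrow> cdvec" where
  "cd_fst n x = (\<lambda>i. if i < 2 ^ (n - 1) then x i else 0)"

definition cd_snd :: "nat \<Rightarrow> cdvec \<Rightarrow> cdvec" where
  "cd_snd n x = (\<lambda>i. if i < 2 ^ (n - 1) then x (2 ^ (n - 1) + i) else 0)"

text \<open>Levels below \<open>3\<close> are not used; the recursion stops at the octonions.\<close>

fun cd_conj :: "nat \<Rightarrow> cdvec \<Rightarrow> cdvec" where
  "cd_conj n x =
     (if n \<le> 3 then oct_conj x
      else cd_join n (cd_conj (n - 1) (cd_fst n x)) (- cd_snd n x))"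

fun cd_mult :: "nat \<Rightarrow> cdvec \<Rightarrow> cdvec \<Rightarrow> cdvec" where
  "cd_mult n x y =
     (if n \<le> 3 then oct_mult x y
      else let a = cd_fst n x; b = cd_snd n x; c = cd_fst n y; d = cd_snd n y in
        cd_join n
          (cd_mult (n - 1) a c - cd_mult (n - 1) (cd_conj (n - 1) d) b)
          (cd_mult (n - 1) d a + cd_mult (n - 1) b (cd_conj (n - 1) c)))"

declare cd_conj.simps [simp del] cd_mult.simps [simp del]

definition cd_inner :: "nat \<Rightarrow> cdvec \<Rightarrow> cdvec \<Rightarrow> cdvec" where
  "cd_inner n s w = proj_oct (cd_mult n s (cd_conj n w))"


section \<open>The canonical basis\<close>

text \<open>
  The coordinate vectors \<open>cd_basis i\<close> are the canonical basis: \<open>e\<^bsub>2^(n-1)+j\<^esub> = e\<^sub>j e\<^bsub>2^(n-1)\<^esub>\<close> is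
  \<open>e_upper_half\<close>, and \<open>cd_join\<close> is justified by \<open>cd_join_eq\<close>.
\<close>

lemma oct_mult_zero [simp]: "oct_mult 0 y = 0" "oct_mult x 0 = 0"
  by (simp_all add: oct_mult_def)

lemma oct_conj_zero [simp]: "oct_conj 0 = 0"
  by (simp add: oct_conj_def)

lemma oct_conj_e0 [simp]: "oct_conj (cd_basis 0) = cd_basis 0"
proof -
  have "(\<Sum>i = 1..7. cd_basis 0 i *\<^sub>R cd_basis i) = (0 :: cdvec)"
    by (rule sum.neutral) (auto simp: cd_basis_def)
  then show ?thesis
    by (simp add: oct_conj_def cd_basis_def scaleR_fun_def)
qed

lemma cd_fst_zero [simp]: "cd_fst n 0 = 0"
  and cd_snd_zero [simp]: "cd_snd n 0 = 0"
  and cd_join_zero [simp]: "cd_join n 0 0 = 0"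
  and cd_fst_e0 [simp]: "cd_fst n (cd_basis 0) = cd_basis 0"
  and cd_snd_e0 [simp]: "cd_snd n (cd_basis 0) = 0"
  and cd_join_e0 [simp]: "cd_join n (cd_basis 0) 0 = cd_basis 0"
  by (auto simp: cd_fst_def cd_snd_def cd_join_def cd_basis_def fun_eq_iff)

lemma cd_conj_zero [simp]: "cd_conj n 0 = 0"
proof (induction n rule: less_induct)
  case (less n)
  have "cd_conj m 0 = 0" if "m < n" for m
    by (rule less[OF that])
  then show "cd_conj n 0 = 0"
    by (cases "n \<le> 3") (simp_all add: cd_conj.simps[of n 0])
qed

lemma cd_conj_e0 [simp]: "cd_conj n (cd_basis 0) = cd_basis 0"
proof (induction n rule: less_induct)
  case (less n)
  show ?case
    by (cases "n \<le> 3") (simp_all add: cd_conj.simps[of n "cd_basis 0"] less)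
qed

lemma cd_mult_zero [simp]: "cd_mult n 0 y = 0" "cd_mult n y 0 = 0"
proof (induction n arbitrary: y rule: less_induct)
  case (less n)
  have IH: "cd_mult m 0 y = 0" "cd_mult m y 0 = 0" if "m < n" for m y
    by (rule less[OF that])+
  { case 1
    show "cd_mult n 0 y = 0"
      by (cases "n \<le> 3") (simp_all add: cd_mult.simps[of n 0] IH)
  }
  { case 2
    show "cd_mult n y 0 = 0"
      by (cases "n \<le> 3") (simp_all add: cd_mult.simps[of n _ 0] IH)
  }
qed

lemma sum_cdvec_apply: "(\<Sum>i\<in>A. f i) k = (\<Sum>i\<in>A. f i k)" for f :: "'a \<Rightarrow> cdvec"
  by (induction A rule: infinite_finite_induct) auto

lemma oct_mult_e0:
  assumes "x \<in> octonions"
  shows "oct_mult (cd_basis 0) x = x" "oct_mult x (cd_basis 0) = x"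
proof -
  have *: "(\<Sum>j<8. x j * (if k = j then 1 else 0)) = x k" for k
  proof -
    have "(\<Sum>j<8. x j * (if k = j then 1 else 0)) = (\<Sum>j<8. if k = j then x j else 0)"
      by (intro sum.cong) auto
    also have "\<dots> = x k"
      using assms by (auto simp: cd_carrier_def)
    finally show ?thesis .
  qed
  have "oct_mult (cd_basis 0) x k = x k" for k
  proof -
    have "oct_mult (cd_basis 0) x k
        = (\<Sum>i<8::nat. if i = 0 then (\<Sum>j<8. x j * (if k = j then 1 else 0)) else 0)"
      unfolding oct_mult_def sum_cdvec_apply
      by (intro sum.cong refl) (auto simp: oct_basis_mult_def cd_basis_def scaleR_fun_def)
    then show ?thesis by (simp add: *)
  qed
  moreover have "oct_mult x (cd_basis 0) k = x k" for k
  proof -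
    have "oct_mult x (cd_basis 0) k
        = (\<Sum>j<8. \<Sum>i<8::nat. if i = 0 then x j * (if k = j then 1 else 0) else 0)"
      unfolding oct_mult_def sum_cdvec_apply
      by (intro sum.cong refl) (auto simp: oct_basis_mult_def cd_basis_def scaleR_fun_def)
    then show ?thesis by (simp add: *)
  qed
  ultimately show "oct_mult (cd_basis 0) x = x" "oct_mult x (cd_basis 0) = x" by auto
qed

lemma cd_mult_e0:
  assumes "n \<ge> 3" "x \<in> cd_carrier n"
  shows "cd_mult n (cd_basis 0) x = x" "cd_mult n x (cd_basis 0) = x"
proof -
  have "\<forall>x \<in> cd_carrier n. cd_mult n (cd_basis 0) x = x \<and> cd_mult n x (cd_basis 0) = x"
    using assms(1)
  proof (induction n rule: dec_induct)
    case base
    show ?case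
      by (simp add: cd_mult.simps[of 3 "cd_basis 0"] cd_mult.simps[of 3 _ "cd_basis 0"] oct_mult_e0)
  next
    case (step n)
    show ?case
    proof
      fix x assume x: "x \<in> cd_carrier (Suc n)"
      have "cd_fst (Suc n) x \<in> cd_carrier n" "cd_snd (Suc n) x \<in> cd_carrier n"
        by (auto simp: cd_carrier_def cd_fst_def cd_snd_def)
      moreover have "cd_join (Suc n) (cd_fst (Suc n) x) (cd_snd (Suc n) x) = x"
        using x by (auto simp: cd_join_def cd_fst_def cd_snd_def cd_carrier_def fun_eq_iff)
      ultimately show "cd_mult (Suc n) (cd_basis 0) x = x \<and> cd_mult (Suc n) x (cd_basis 0) = x"
        using step
        by (simp add: cd_mult.simps[of "Suc n" "cd_basis 0"] cd_mult.simps[of "Suc n" _ "cd_basis 0"])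
    qed
  qed
  then show "cd_mult n (cd_basis 0) x = x" "cd_mult n x (cd_basis 0) = x"
    using assms(2) by auto
qed

lemma cd_mult_generator:
  assumes "n \<ge> 4" "b \<in> cd_carrier (n - 1)"
  shows "cd_mult n b (cd_basis (2 ^ (n - 1))) = cd_join n 0 b"
proof -
  have "(2::nat) ^ n = 2 * 2 ^ (n - 1)"
    using assms(1) by (cases n) auto
  then have "cd_fst n (cd_basis (2 ^ (n - 1))) = 0" "cd_snd n (cd_basis (2 ^ (n - 1))) = cd_basis 0"
    by (auto simp: cd_fst_def cd_snd_def cd_basis_def fun_eq_iff)
  moreover have "cd_fst n b = b" "cd_snd n b = 0"
    using assms(2) by (auto simp: cd_fst_def cd_snd_def cd_carrier_def fun_eq_iff)
  ultimately show ?thesis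
    using assms by (simp add: cd_mult.simps[of n b] cd_mult_e0)
qed

lemma cd_join_eq:
  assumes "n \<ge> 4" "a \<in> cd_carrier (n - 1)" "b \<in> cd_carrier (n - 1)"
  shows "cd_join n a b = a + cd_mult n b (cd_basis (2 ^ (n - 1)))"
proof -
  have "(2::nat) ^ n = 2 * 2 ^ (n - 1)"
    using assms(1) by (cases n) auto
  then have "cd_join n a b = a + cd_join n 0 b"
    using assms by (auto simp: cd_join_def cd_carrier_def fun_eq_iff)
  then show ?thesis
    using cd_mult_generator[OF assms(1,3)] by simp
qed

lemma e_upper_half:
  assumes "n \<ge> 4" "j < 2 ^ (n - 1)"
  shows "cd_basis (2 ^ (n - 1) + j) = cd_mult n (cd_basis j) (cd_basis (2 ^ (n - 1)))"
proof -
  have "(2::nat) ^ n = 2 * 2 ^ (n - 1)"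
    using assms(1) by (cases n) auto
  moreover have "cd_basis j \<in> cd_carrier (n - 1)"
    using assms(2) by (auto simp: cd_carrier_def cd_basis_def)
  ultimately show ?thesis
    unfolding cd_mult_generator[OF assms(1) \<open>cd_basis j \<in> _\<close>]
    using assms by (auto simp: cd_join_def cd_basis_def fun_eq_iff)
qed


section \<open>Hilbert left octonionic modules\<close>

locale left_oct_module =
  fixes M :: "'m::real_vector set" and L :: "cdvec \<Rightarrow> 'm \<Rightarrow> 'm"
  assumes subspace: "subspace M"
    and L_closed: "p \<in> octonions \<Longrightarrow> x \<in> M \<Longrightarrow> L p x \<in> M"
    and L_add_right: "p \<in> octonions \<Longrightarrow> x \<in> M \<Longrightarrow> y \<in> M \<Longrightarrow> L p (x + y) = L p x + L p y"
    and L_scaleR_right: "p \<in> octonions \<Longrightarrow> x \<in> M \<Longrightarrow> L p (r *\<^sub>R x) = r *\<^sub>R L p x"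
    and L_add_left: "p \<in> octonions \<Longrightarrow> q \<in> octonions \<Longrightarrow> x \<in> M \<Longrightarrow> L (p + q) x = L p x + L q x"
    and L_scaleR_left: "p \<in> octonions \<Longrightarrow> x \<in> M \<Longrightarrow> L (r *\<^sub>R p) x = r *\<^sub>R L p x"
    and L_one: "x \<in> M \<Longrightarrow> L (cd_basis 0) x = x"
    and L_square: "p \<in> octonions \<Longrightarrow> x \<in> M \<Longrightarrow> L p (L p x) = L (oct_mult p p) x"

text \<open>
  The norm is \<open>\<surd>\<langle>u, u\<rangle>\<close>; \<open>\<langle>u, u\<rangle>\<close> is a nonnegative real multiple of \<open>cd_basis 0\<close>, read off as a real number
  by its coordinate at \<open>0\<close>.
\<close>

definition oct_norm :: "('m \<Rightarrow> 'm \<Rightarrow> cdvec) \<Rightarrow> 'm \<Rightarrow> real" where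
  "oct_norm ip u = sqrt (ip u u 0)"

locale hilbert_left_oct_module = left_oct_module M L
  for M :: "'m::real_vector set" and L :: "cdvec \<Rightarrow> 'm \<Rightarrow> 'm" +
  fixes ip :: "'m \<Rightarrow> 'm \<Rightarrow> cdvec"
  assumes ip_closed: "u \<in> M \<Longrightarrow> v \<in> M \<Longrightarrow> ip u v \<in> octonions"
    and ip_add_left: "u \<in> M \<Longrightarrow> u' \<in> M \<Longrightarrow> v \<in> M \<Longrightarrow> ip (u + u') v = ip u v + ip u' v"
    and ip_scaleR_left: "u \<in> M \<Longrightarrow> v \<in> M \<Longrightarrow> ip (r *\<^sub>R u) v = r *\<^sub>R ip u v"
    and ip_add_right: "u \<in> M \<Longrightarrow> v \<in> M \<Longrightarrow> v' \<in> M \<Longrightarrow> ip u (v + v') = ip u v + ip u v'"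
    and ip_scaleR_right: "u \<in> M \<Longrightarrow> v \<in> M \<Longrightarrow> ip u (r *\<^sub>R v) = r *\<^sub>R ip u v"
    and ip_para_linear: "p \<in> octonions \<Longrightarrow> u \<in> M \<Longrightarrow> v \<in> M \<Longrightarrow>
      oct_Re (ip (L p u) v - oct_mult p (ip u v)) = 0"
    and ip_hermitian: "u \<in> M \<Longrightarrow> v \<in> M \<Longrightarrow> ip u v = oct_conj (ip v u)"
    and ip_nonneg: "u \<in> M \<Longrightarrow> \<exists>r\<ge>0. ip u u = r *\<^sub>R cd_basis 0"
    and ip_definite: "u \<in> M \<Longrightarrow> ip u u = 0 \<longleftrightarrow> u = 0"
    and complete: "(\<And>k. \<sigma> k \<in> M) \<Longrightarrow>
      (\<And>\<epsilon>. \<epsilon> > 0 \<Longrightarrow> \<exists>N::nat. \<forall>j\<ge>N. \<forall>k\<ge>N. oct_norm ip (\<sigma> j - \<sigma> k) < \<epsilon>) \<Longrightarrow>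
      \<exists>l\<in>M. (\<lambda>k. oct_norm ip (\<sigma> k - l)) \<longlonglongrightarrow> 0"

definition second_assoc ::
    "(cdvec \<Rightarrow> 'm \<Rightarrow> 'm) \<Rightarrow> ('m \<Rightarrow> 'm \<Rightarrow> cdvec) \<Rightarrow> cdvec \<Rightarrow> 'm \<Rightarrow> 'm \<Rightarrow> cdvec" where
  "second_assoc L ip p u v = ip (L p u) v - oct_mult p (ip u v)"

definition orthonormal_system :: "'m set \<Rightarrow> ('m \<Rightarrow> 'm \<Rightarrow> cdvec) \<Rightarrow> 'm set \<Rightarrow> bool" where
  "orthonormal_system M ip S \<longleftrightarrow>
     S \<subseteq> M \<and> (\<forall>x\<in>S. \<forall>y\<in>S. ip x y = (if x = y then cd_basis 0 else 0))"

definition orthonormal_basis :: "'m set \<Rightarrow> ('m \<Rightarrow> 'm \<Rightarrow> cdvec) \<Rightarrow> 'm set \<Rightarrow> bool" where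
  "orthonormal_basis M ip S \<longleftrightarrow>
     orthonormal_system M ip S \<and> \<not> (\<exists>T. orthonormal_system M ip T \<and> S \<subset> T)"

definition weak_associative_basis ::
    "'m set \<Rightarrow> (cdvec \<Rightarrow> 'm \<Rightarrow> 'm) \<Rightarrow> ('m \<Rightarrow> 'm \<Rightarrow> cdvec) \<Rightarrow> 'm set \<Rightarrow> bool" where
  "weak_associative_basis M L ip S \<longleftrightarrow>
     orthonormal_basis M ip S \<and>
     (\<forall>p\<in>octonions. \<forall>x\<in>S. \<forall>y\<in>S. second_assoc L ip p x y = 0)"

end

theory Submission
  imports Defs
begin

text \<open>
  The identities \<open>x x\<^sup>* = \<parallel>x\<parallel>\<^sup>2\<close> and \<open>Re ((x y) z) = Re (x (y z))\<close> survive every Cayley--Dickson doubling,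
  whereas alternativity is lost; but \<open>p (a + b e) = p a + (b p) e\<close> for an octonion \<open>p\<close>, so that
  \<open>p (p x) = p\<^sup>2 x\<close> follows at the next level from this identity and its conjugate \<open>(x p) p = x p\<^sup>2\<close>.
  In the same way \<open>\<pi> ((p e\<^bsub>8i\<^esub>) e\<^bsub>8k\<^esub>\<^sup>*) = \<delta>\<^bsub>ik\<^esub> p\<close> by doubling: if both indices lie in the upper half,
  it is the conjugate of the same identity one level below. Since the vectors \<open>p e\<^bsub>8i\<^esub>\<close> span, this
  gives the expansion, and a vector orthogonal to all \<open>e\<^bsub>8i\<^esub>\<close> vanishes by its expansion.
\<close>

section \<open>Octonions in coordinates\<close>

text \<open>With the product written out in eight coordinates, the octonion identities that start
  the inductions below become polynomial identities over the reals, which \<open>simp\<close>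
  verifies.\<close>

lemma oct_mult_coords:
  "oct_mult x y = (\<lambda>k.
     if k = 0 then x 0 * y 0 - x 1 * y 1 - x 2 * y 2 - x 3 * y 3 - x 4 * y 4 - x 5 * y 5 - x 6 * y 6 - x 7 * y 7
     else if k = 1 then x 0 * y 1 + x 1 * y 0 + x 2 * y 3 - x 3 * y 2 + x 4 * y 5 - x 5 * y 4 + x 7 * y 6 - x 6 * y 7
     else if k = 2 then x 0 * y 2 + x 2 * y 0 + x 3 * y 1 - x 1 * y 3 + x 4 * y 6 - x 6 * y 4 + x 5 * y 7 - x 7 * y 5
     else if k = 3 then x 0 * y 3 + x 3 * y 0 + x 1 * y 2 - x 2 * y 1 + x 4 * y 7 - x 7 * y 4 + x 6 * y 5 - x 5 * y 6
     else if k = 4 then x 0 * y 4 + x 4 * y 0 + x 5 * y 1 - x 1 * y 5 + x 6 * y 2 - x 2 * y 6 + x 7 * y 3 - x 3 * y 7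
     else if k = 5 then x 0 * y 5 + x 5 * y 0 + x 1 * y 4 - x 4 * y 1 + x 7 * y 2 - x 2 * y 7 + x 3 * y 6 - x 6 * y 3
     else if k = 6 then x 0 * y 6 + x 6 * y 0 + x 1 * y 7 - x 7 * y 1 + x 2 * y 4 - x 4 * y 2 + x 5 * y 3 - x 3 * y 5
     else if k = 7 then x 0 * y 7 + x 7 * y 0 + x 6 * y 1 - x 1 * y 6 + x 2 * y 5 - x 5 * y 2 + x 3 * y 4 - x 4 * y 3
     else 0)"
  (is "_ = ?rhs")
proof
  fix k :: nat
  have eps: "(\<Sum>l = 1..7. oct_eps i j l *\<^sub>R cd_basis l) k = (if k \<in> {1..7} then oct_eps i j k else 0)" for i j
  proof -
    have "(\<Sum>l = 1..7. oct_eps i j l *\<^sub>R cd_basis l) k = (\<Sum>l = 1..7. if k = l then oct_eps i j l else 0)"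
      unfolding sum_cdvec_apply by (intro sum.cong) (auto simp: scaleR_fun_def cd_basis_def)
    then show ?thesis by simp
  qed
  have b: "oct_basis_mult i j k = (if i = 0 then if k = j then 1 else 0 else if j = 0 then if k = i then 1 else 0
      else (if k \<in> {1..7} then oct_eps i j k else 0) - (if i = j \<and> k = 0 then 1 else 0))" for i j
    unfolding oct_basis_mult_def using eps[of i j] by (auto simp: scaleR_fun_def cd_basis_def)
  have m: "oct_mult x y k = (\<Sum>i<8. \<Sum>j<8. x i * y j * oct_basis_mult i j k)"
    by (simp add: oct_mult_def sum_cdvec_apply scaleR_fun_def)
  \<comment> \<open>For each fixed coordinate below 8 the double sum is a finite computation with
    the multiplication table; from 8 on both sides vanish.\<close>
  have k: "k \<in> {0,1,2,3,4,5,6,7} \<or> k \<ge> 8" by auto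
  have l8: "{..<8::nat} = {0,1,2,3,4,5,6,7}" by auto
  show "oct_mult x y k = ?rhs k"
    using k unfolding m b l8
    by (elim disjE insertE emptyE) (simp_all add: oct_eps_def oct_triples_def)
qed

lemma oct_conj_apply: "oct_conj x = (\<lambda>k. if k = 0 then x 0 else if k < 8 then - x k else 0)"
proof
  fix k
  have "(\<Sum>l = 1..7. x l *\<^sub>R cd_basis l) k = (\<Sum>l = 1..7. if k = l then x l else 0)"
    unfolding sum_cdvec_apply by (intro sum.cong) (auto simp: scaleR_fun_def cd_basis_def)
  then show "oct_conj x k = (if k = 0 then x 0 else if k < 8 then - x k else 0)"
    by (auto simp: oct_conj_def scaleR_fun_def cd_basis_def)
qed

section \<open>Octonion identities serving as base cases\<close>

lemma oct_conj_mult: "oct_conj (oct_mult x y) = oct_mult (oct_conj y) (oct_conj x)"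
  unfolding oct_mult_coords oct_conj_apply by (rule ext) simp

lemma oct_mult_self_conj: "oct_mult x (oct_conj x) = (\<Sum>i<8. (x i)\<^sup>2) *\<^sub>R cd_basis 0"
  unfolding oct_mult_coords oct_conj_apply
  by (rule ext) (simp add: scaleR_fun_def cd_basis_def eval_nat_numeral)

lemma oct_Re_commute: "oct_mult x y 0 = oct_mult y x 0"
  unfolding oct_mult_coords by simp

lemma oct_Re_assoc: "oct_mult (oct_mult x y) z 0 = oct_mult x (oct_mult y z) 0"
  unfolding oct_mult_coords by (simp add: algebra_simps)

lemma oct_left_alternative: "oct_mult x (oct_mult x y) = oct_mult (oct_mult x x) y"
  unfolding oct_mult_coords by (rule ext) (simp add: algebra_simps)

lemma oct_mult_in_octonions: "oct_mult x y \<in> octonions"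
  unfolding oct_mult_coords cd_carrier_def by simp

lemma oct_conj_in_octonions: "oct_conj x \<in> octonions"
  unfolding oct_conj_apply cd_carrier_def by simp

lemma linear_oct_conj: "linear oct_conj"
  by (rule linearI) (simp_all add: oct_conj_apply scaleR_fun_def fun_eq_iff)

lemma linear_oct_mult: "linear (oct_mult x)" "linear (\<lambda>x. oct_mult x y)"
  by (rule linearI;
      simp add: oct_mult_def scaleR_fun_def fun_eq_iff sum_cdvec_apply sum.distrib sum_distrib_left
        algebra_simps)+


section \<open>Pairs\<close>

lemma subspace_cd_carrier: "subspace (cd_carrier n)"
  by (auto simp: subspace_def cd_carrier_def scaleR_fun_def)

lemmas cd_carrier_closed [simp] =
  subspace_0[OF subspace_cd_carrier] subspace_add[OF subspace_cd_carrier]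
  subspace_diff[OF subspace_cd_carrier] subspace_neg[OF subspace_cd_carrier]
  subspace_scale[OF subspace_cd_carrier] subspace_sum[OF subspace_cd_carrier]

lemma cd_carrier_mono: "m \<le> n \<Longrightarrow> cd_carrier m \<subseteq> cd_carrier n"
  using order_trans[OF power_increasing[of m n "2::nat"]] by (auto simp: cd_carrier_def)

lemma cd_join_in_carrier [simp]: "cd_join n a b \<in> cd_carrier n"
proof -
  have "i < 2 ^ n" if "i < 2 ^ (n - Suc 0)" for i :: nat
    using that by (rule less_le_trans) (rule power_increasing, auto)
  then show ?thesis
    by (force simp: cd_join_def cd_carrier_def)
qed

lemma cd_fst_in_carrier [simp]: "cd_fst (Suc n) x \<in> cd_carrier n"
  and cd_snd_in_carrier [simp]: "cd_snd (Suc n) x \<in> cd_carrier n"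
  by (auto simp: cd_fst_def cd_snd_def cd_carrier_def)

lemma cd_join_fst_snd:
  "x \<in> cd_carrier (Suc n) \<Longrightarrow> cd_join (Suc n) (cd_fst (Suc n) x) (cd_snd (Suc n) x) = x"
  by (auto simp: cd_join_def cd_fst_def cd_snd_def cd_carrier_def fun_eq_iff)

text \<open>Used at each inductive step to pass from an element of level \<open>Suc n\<close> to a
  pair over level \<open>n\<close>, so that the pair formulas for product and conjugation
  apply.\<close>

lemma cd_carrier_SucE:
  assumes "x \<in> cd_carrier (Suc n)"
  obtains a b where "a \<in> cd_carrier n" "b \<in> cd_carrier n" "x = cd_join (Suc n) a b"
  using cd_join_fst_snd[OF assms] cd_fst_in_carrier cd_snd_in_carrier by metis

lemma cd_fst_join [simp]: "a \<in> cd_carrier n \<Longrightarrow> cd_fst (Suc n) (cd_join (Suc n) a b) = a"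
  and cd_snd_join [simp]: "b \<in> cd_carrier n \<Longrightarrow> cd_snd (Suc n) (cd_join (Suc n) a b) = b"
  by (auto simp: cd_join_def cd_fst_def cd_snd_def cd_carrier_def fun_eq_iff)

lemma cd_join_add: "cd_join n a b + cd_join n c d = cd_join n (a + c) (b + d)"
  and cd_join_scaleR: "r *\<^sub>R cd_join n a b = cd_join n (r *\<^sub>R a) (r *\<^sub>R b)"
  by (auto simp: cd_join_def fun_eq_iff scaleR_fun_def)

lemma cd_join_apply_0 [simp]: "cd_join n a b 0 = a 0"
  by (simp add: cd_join_def)

lemma cd_join_right_zero: "a \<in> cd_carrier n \<Longrightarrow> cd_join (Suc n) a 0 = a"
  by (auto simp: cd_join_def cd_carrier_def fun_eq_iff)

lemma linear_cd_fst: "linear (cd_fst n)" and linear_cd_snd: "linear (cd_snd n)"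
  by (rule linearI; auto simp: cd_fst_def cd_snd_def scaleR_fun_def fun_eq_iff)+

lemma linear_cd_join:
  assumes "linear f" "linear g"
  shows "linear (\<lambda>x. cd_join n (f x) (g x))"
  using assms by (intro linearI) (simp_all add: cd_join_add cd_join_scaleR linear_add linear_scale)


section \<open>Algebraic identities by doubling\<close>

lemma linear_cd_conj: "linear (cd_conj n)"
proof (induction n rule: less_induct)
  case (less n)
  show ?case
  proof (cases "n \<le> 3")
    case True
    then have "cd_conj n = oct_conj"
      by (simp add: cd_conj.simps[of n] fun_eq_iff)
    then show ?thesis
      by (simp add: linear_oct_conj)
  next
    case False
    then have "linear (cd_conj (n - 1))" by (intro less) auto
    from linear_compose[OF linear_cd_fst this, unfolded o_def]
    have "linear (\<lambda>x. cd_join n (cd_conj (n - 1) (cd_fst n x)) (- cd_snd n x))"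
      by (intro linear_cd_join linear_compose_neg linear_cd_snd)
    also have "(\<lambda>x. cd_join n (cd_conj (n - 1) (cd_fst n x)) (- cd_snd n x)) = cd_conj n"
      using False by (simp add: cd_conj.simps[of n] fun_eq_iff)
    finally show ?thesis .
  qed
qed

text \<open>The two linearities are proved together: in the doubled product the components of either
  factor occur both on the left and on the right. Since \<open>cd_fst\<close> and
  \<open>cd_snd\<close> truncate, linearity holds on all sequences, and the derived rewrite rules
  carry no carrier hypotheses.\<close>

lemma linear_cd_mult: "linear (cd_mult n x) \<and> linear (\<lambda>x. cd_mult n x y)"
proof (induction n arbitrary: x y rule: less_induct)
  case (less n)
  show ?case
  proof (cases "n \<le> 3")
    case True
    then have "cd_mult n = oct_mult"
      by (simp add: cd_mult.simps[of n] fun_eq_iff)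
    then show ?thesis
      by (simp add: linear_oct_mult)
  next
    case False
    then have IH: "linear (cd_mult (n - 1) x)" "linear (\<lambda>x. cd_mult (n - 1) x y)" for x y
      using less[of "n - 1"] by auto
    have mult: "linear (\<lambda>x. cd_mult (n - 1) (f x) y)" "linear (\<lambda>x. cd_mult (n - 1) y (f x))"
      if "linear f" for f :: "cdvec \<Rightarrow> cdvec" and y
      using linear_compose[OF that IH(1)] linear_compose[OF that IH(2)] by (simp_all add: o_def)
    have conj: "linear (\<lambda>x. cd_conj (n - 1) (f x))" if "linear f" for f :: "cdvec \<Rightarrow> cdvec"
      using linear_compose[OF that linear_cd_conj] by (simp add: o_def)
    have eq: "cd_mult n x y = cd_join n
          (cd_mult (n - 1) (cd_fst n x) (cd_fst n y)
            - cd_mult (n - 1) (cd_conj (n - 1) (cd_snd n y)) (cd_snd n x))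
          (cd_mult (n - 1) (cd_snd n y) (cd_fst n x)
            + cd_mult (n - 1) (cd_snd n x) (cd_conj (n - 1) (cd_fst n y)))" for x y
      using False by (simp add: cd_mult.simps[of n] Let_def)
    have "linear (\<lambda>y. cd_mult n x y) \<and> linear (\<lambda>x. cd_mult n x y)"
      unfolding eq
      by (intro conjI linear_cd_join linear_compose_sub linear_compose_add mult conj
          linear_cd_fst linear_cd_snd)
    then show ?thesis by simp
  qed
qed

lemmas cd_conj_linear =
  linear_add[OF linear_cd_conj] linear_diff[OF linear_cd_conj]
  linear_neg[OF linear_cd_conj] linear_scale[OF linear_cd_conj]

lemmas linear_cd_mult_right = linear_cd_mult[THEN conjunct1]
  and linear_cd_mult_left = linear_cd_mult[THEN conjunct2]

lemmas cd_mult_linear =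
  linear_add[OF linear_cd_mult_right] linear_diff[OF linear_cd_mult_right]
  linear_neg[OF linear_cd_mult_right] linear_scale[OF linear_cd_mult_right]
  linear_add[OF linear_cd_mult_left] linear_diff[OF linear_cd_mult_left]
  linear_neg[OF linear_cd_mult_left] linear_scale[OF linear_cd_mult_left]

lemma cd_mult_3: "cd_mult 3 = oct_mult" and cd_conj_3: "cd_conj 3 = oct_conj"
  by (simp_all add: fun_eq_iff cd_mult.simps[of 3] cd_conj.simps[of 3])

section \<open>The doubling formulas and conjugation as an anti-automorphism\<close>

lemma cd_mult_join:
  assumes "n \<ge> 3" "a \<in> cd_carrier n" "b \<in> cd_carrier n" "c \<in> cd_carrier n" "d \<in> cd_carrier n"
  shows "cd_mult (Suc n) (cd_join (Suc n) a b) (cd_join (Suc n) c d) =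
    cd_join (Suc n) (cd_mult n a c - cd_mult n (cd_conj n d) b)
      (cd_mult n d a + cd_mult n b (cd_conj n c))"
  using assms by (simp add: cd_mult.simps[of "Suc n"])

lemma cd_conj_join:
  assumes "n \<ge> 3" "a \<in> cd_carrier n" "b \<in> cd_carrier n"
  shows "cd_conj (Suc n) (cd_join (Suc n) a b) = cd_join (Suc n) (cd_conj n a) (- b)"
  using assms by (simp add: cd_conj.simps[of "Suc n"])

lemma cd_mult_in_carrier [simp]: "n \<ge> 3 \<Longrightarrow> cd_mult n x y \<in> cd_carrier n"
  by (cases "n = 3") (simp_all add: cd_mult_3 oct_mult_in_octonions cd_mult.simps[of n] Let_def)

lemma cd_conj_in_carrier [simp]: "n \<ge> 3 \<Longrightarrow> cd_conj n x \<in> cd_carrier n"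
  by (cases "n = 3") (simp_all add: cd_conj_3 oct_conj_in_octonions cd_conj.simps[of n])

text \<open>Doubling conjugates the first component and negates the second, so only the coordinate
  at 0 ever keeps its sign. In particular conjugation preserves the real part and does not depend on
  the level.\<close>

lemma cd_conj_apply:
  assumes "n \<ge> 3" "x \<in> cd_carrier n"
  shows "cd_conj n x = (\<lambda>i. if i = 0 then x 0 else - x i)"
  using assms
proof (induction n arbitrary: x rule: dec_induct)
  case base
  then show ?case by (auto simp: cd_conj_3 oct_conj_apply cd_carrier_def fun_eq_iff)
next
  case (step n)
  from step.prems obtain a b
    where "a \<in> cd_carrier n" "b \<in> cd_carrier n" "x = cd_join (Suc n) a b"
    by (rule cd_carrier_SucE)
  with step have "cd_conj (Suc n) x = cd_join (Suc n) (\<lambda>i. if i = 0 then a 0 else - a i) (- b)"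
    by (simp add: cd_conj_join)
  then show ?case
    unfolding \<open>x = _\<close> by (auto simp: cd_join_def fun_eq_iff)
qed

lemma cd_conj_conj:
  assumes "n \<ge> 3" "x \<in> cd_carrier n"
  shows "cd_conj n (cd_conj n x) = x"
  using assms cd_conj_apply[OF assms(1) cd_conj_in_carrier[OF assms(1)], of x]
  by (auto simp: cd_conj_apply fun_eq_iff)

lemma cd_conj_mult:
  assumes "n \<ge> 3" "x \<in> cd_carrier n" "y \<in> cd_carrier n"
  shows "cd_conj n (cd_mult n x y) = cd_mult n (cd_conj n y) (cd_conj n x)"
  using assms
proof (induction n arbitrary: x y rule: dec_induct)
  case base
  then show ?case by (simp add: cd_conj_3 cd_mult_3 oct_conj_mult)
next
  case (step n)
  obtain a b where x: "a \<in> cd_carrier n" "b \<in> cd_carrier n" "x = cd_join (Suc n) a b"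
    using step.prems(1) by (rule cd_carrier_SucE)
  obtain c d where y: "c \<in> cd_carrier n" "d \<in> cd_carrier n" "y = cd_join (Suc n) c d"
    using step.prems(2) by (rule cd_carrier_SucE)
  show ?case
    using x y step.hyps
    by (simp add: cd_mult_join cd_conj_join step.IH cd_conj_linear cd_mult_linear cd_conj_conj
        algebra_simps)
qed

section \<open>Real parts of products, and the norm\<close>

lemma cd_Re_commute:
  assumes "n \<ge> 3" "x \<in> cd_carrier n" "y \<in> cd_carrier n"
  shows "cd_mult n x y 0 = cd_mult n y x 0"
  using assms
proof (induction n arbitrary: x y rule: dec_induct)
  case base
  then show ?case by (simp add: cd_mult_3 oct_Re_commute)
next
  case (step n)
  obtain a b where x: "a \<in> cd_carrier n" "b \<in> cd_carrier n" "x = cd_join (Suc n) a b"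
    using step.prems(1) by (rule cd_carrier_SucE)
  obtain c d where y: "c \<in> cd_carrier n" "d \<in> cd_carrier n" "y = cd_join (Suc n) c d"
    using step.prems(2) by (rule cd_carrier_SucE)
  \<comment> \<open>The real part of the doubled product is Re(ac) - Re(d* b). Commutativity at
    level \<open>n\<close> handles the first term; the second becomes Re(b* d), its counterpart in
    the swapped product, because conjugation preserves the real part.\<close>
  have "cd_mult n (cd_conj n d) b 0 = cd_conj n (cd_mult n (cd_conj n d) b) 0"
    using step.hyps by (simp add: cd_conj_apply)
  also have "\<dots> = cd_mult n (cd_conj n b) d 0"
    using x y step.hyps by (simp add: cd_conj_mult cd_conj_conj)
  finally show ?case
    using x y step.hyps step.IH[of a c] by (simp add: cd_mult_join)
qed

text \<open>Both real parts expand into four terms at the lower level. The terms in a, c, e agree by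
  the induction hypothesis, and the other three match in pairs after cyclic rotation.\<close>

lemma cd_Re_assoc:
  assumes "n \<ge> 3" "x \<in> cd_carrier n" "y \<in> cd_carrier n" "z \<in> cd_carrier n"
  shows "cd_mult n (cd_mult n x y) z 0 = cd_mult n x (cd_mult n y z) 0"
  using assms
proof (induction n arbitrary: x y z rule: dec_induct)
  case base
  then show ?case by (simp add: cd_mult_3 oct_Re_assoc)
next
  case (step n)
  obtain a b where x: "a \<in> cd_carrier n" "b \<in> cd_carrier n" "x = cd_join (Suc n) a b"
    using step.prems(1) by (rule cd_carrier_SucE)
  obtain c d where y: "c \<in> cd_carrier n" "d \<in> cd_carrier n" "y = cd_join (Suc n) c d"
    using step.prems(2) by (rule cd_carrier_SucE)
  obtain e f where z: "e \<in> cd_carrier n" "f \<in> cd_carrier n" "z = cd_join (Suc n) e f"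
    using step.prems(3) by (rule cd_carrier_SucE)
  note com = cd_Re_commute[OF step.hyps(1)]
  \<comment> \<open>Cyclic invariance of the real part of a triple product:
    \<open>cd_Re_commute\<close> combined with the induction hypothesis.\<close>
  have rotate: "cd_mult n (cd_mult n u v) w 0 = cd_mult n (cd_mult n w u) v 0"
    if "u \<in> cd_carrier n" "v \<in> cd_carrier n" "w \<in> cd_carrier n" for u v w
    using that step.hyps com[of "cd_mult n u v" w] by (simp add: step.IH)
  have 1: "cd_mult n (cd_mult n (cd_conj n d) b) e 0 = cd_mult n (cd_mult n e (cd_conj n d)) b 0"
    using x y z step.hyps by (intro rotate) auto
  have 2: "cd_mult n (cd_conj n f) (cd_mult n d a) 0 = cd_mult n a (cd_mult n (cd_conj n f) d) 0"
    using x y z step.hyps com[of a "cd_mult n (cd_conj n f) d"] step.IH[of "cd_conj n f" d a] by simp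
  have 3: "cd_mult n (cd_conj n f) (cd_mult n b (cd_conj n c)) 0
      = cd_mult n (cd_mult n (cd_conj n c) (cd_conj n f)) b 0"
    using x y z step.hyps rotate[of "cd_conj n f" b "cd_conj n c"]
      step.IH[of "cd_conj n f" b "cd_conj n c"] by simp
  show ?case
    using x y z step.hyps step.IH[of a c e] 1 2 3
    by (simp add: cd_mult_join cd_conj_linear cd_mult_linear cd_conj_mult cd_conj_conj)
qed

lemma sum_lessThan_add:
  fixes f :: "nat \<Rightarrow> 'a::comm_monoid_add"
  shows "sum f {..<m + k} = sum f {..<m} + (\<Sum>i<k. f (m + i))"
  by (induction k) (simp_all add: add.assoc)

text \<open>For x = (a, b) the doubled product is (a a* + b* b, -b a + b a): the second component
  cancels and the first is a sum of two norms.\<close>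

lemma cd_mult_self_conj:
  assumes "n \<ge> 3" "x \<in> cd_carrier n"
  shows "cd_mult n x (cd_conj n x) = (\<Sum>i<2 ^ n. (x i)\<^sup>2) *\<^sub>R cd_basis 0"
  using assms
proof (induction n arbitrary: x rule: dec_induct)
  case base
  then show ?case by (simp add: cd_mult_3 cd_conj_3 oct_mult_self_conj)
next
  case (step n)
  obtain a b where x: "a \<in> cd_carrier n" "b \<in> cd_carrier n" "x = cd_join (Suc n) a b"
    using step.prems by (rule cd_carrier_SucE)
  \<comment> \<open>The induction hypothesis is applied to b*, whose coordinates have the same
    squares as those of b; this yields b* b in place of b b*.\<close>
  have b: "cd_mult n (cd_conj n b) b = (\<Sum>i<2 ^ n. (b i)\<^sup>2) *\<^sub>R cd_basis 0"
  proof -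
    have "cd_mult n (cd_conj n b) b = (\<Sum>i<2 ^ n. (cd_conj n b i)\<^sup>2) *\<^sub>R cd_basis 0"
      using step.IH[of "cd_conj n b"] x step.hyps by (simp add: cd_conj_conj)
    also have "(\<Sum>i<2 ^ n. (cd_conj n b i)\<^sup>2) = (\<Sum>i<2 ^ n. (b i)\<^sup>2)"
      using x step.hyps by (intro sum.cong) (auto simp: cd_conj_apply)
    finally show ?thesis .
  qed
  have e0: "cd_basis 0 \<in> cd_carrier n"
    by (simp add: cd_carrier_def cd_basis_def)
  have "cd_mult (Suc n) x (cd_conj (Suc n) x)
      = cd_join (Suc n) (cd_mult n a (cd_conj n a) + cd_mult n (cd_conj n b) b) 0"
    using x step.hyps by (simp add: cd_mult_join cd_conj_join cd_conj_linear cd_mult_linear cd_conj_conj)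
  also have "\<dots> = ((\<Sum>i<2 ^ n. (a i)\<^sup>2) + (\<Sum>i<2 ^ n. (b i)\<^sup>2)) *\<^sub>R cd_basis 0"
    using x e0 by (simp add: step.IH b cd_join_right_zero scaleR_add_left)
  also have "(\<Sum>i<2 ^ n. (a i)\<^sup>2) + (\<Sum>i<2 ^ n. (b i)\<^sup>2) = (\<Sum>i<2 ^ Suc n. (x i)\<^sup>2)"
    by (simp add: x(3) mult_2 sum_lessThan_add cd_join_def)
  finally show ?case .
qed


section \<open>Multiplication by octonions\<close>

lemma octonions_subset: "n \<ge> 3 \<Longrightarrow> p \<in> octonions \<Longrightarrow> p \<in> cd_carrier n"
  using cd_carrier_mono by blast

lemma cd_conj_in_octonions [simp]: "n \<ge> 3 \<Longrightarrow> p \<in> octonions \<Longrightarrow> cd_conj n p \<in> octonions"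
  using octonions_subset[of n p] by (simp add: cd_conj_apply) (simp add: cd_carrier_def)

text \<open>The doubling formula for a left factor (x, 0). The second component is multiplied from
  the right, so later inductions need the conjugated form of their hypothesis there.\<close>

lemma cd_mult_lower:
  assumes "n \<ge> 3" "x \<in> cd_carrier n" "a \<in> cd_carrier n" "b \<in> cd_carrier n"
  shows "cd_mult (Suc n) x (cd_join (Suc n) a b) = cd_join (Suc n) (cd_mult n x a) (cd_mult n b x)"
  using cd_mult_join[of n x 0 a b] assms by (simp add: cd_join_right_zero)

lemma cd_mult_oct:
  assumes "n \<ge> 3" "p \<in> octonions" "q \<in> octonions"
  shows "cd_mult n p q = oct_mult p q"
  using assms
proof (induction n rule: dec_induct)
  case base
  then show ?case by (simp add: cd_mult_3)
next
  case (step n)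
  then show ?case
    using cd_mult_lower[of n p q 0] octonions_subset[of n p] octonions_subset[of n q]
      octonions_subset[of n "oct_mult p q"] oct_mult_in_octonions[of p q]
    by (simp add: cd_join_right_zero)
qed

lemma cd_left_alternative:
  assumes "n \<ge> 3" "p \<in> octonions" "x \<in> cd_carrier n"
  shows "cd_mult n p (cd_mult n p x) = cd_mult n (oct_mult p p) x"
  using assms
proof (induction n arbitrary: p x rule: dec_induct)
  case base
  then show ?case by (simp add: cd_mult_3 oct_left_alternative)
next
  case (step n)
  obtain a b where x: "a \<in> cd_carrier n" "b \<in> cd_carrier n" "x = cd_join (Suc n) a b"
    using step.prems(2) by (rule cd_carrier_SucE)
  note p = octonions_subset[OF step.hyps(1) step.prems(1)]
  \<comment> \<open>The second component requires (b p) p = b (p p). Its conjugate is the induction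
    hypothesis for p* and b*; the flipped \<open>cd_mult_oct\<close> turns octonion products into
    products of level \<open>n\<close>, to which \<open>cd_conj_mult\<close> applies. Conjugation is
    then undone by \<open>cd_conj_conj\<close>.\<close>
  have "cd_conj n (cd_mult n (cd_mult n b p) p) = cd_conj n (cd_mult n b (oct_mult p p))"
    using step.IH[of "cd_conj n p" "cd_conj n b"] step.hyps step.prems x p
    by (simp add: cd_conj_mult flip: cd_mult_oct[of n])
  then have "cd_mult n (cd_mult n b p) p = cd_mult n b (oct_mult p p)"
    using cd_conj_conj cd_mult_in_carrier step.hyps(1) by metis
  then show ?case
    using x p step octonions_subset[OF step.hyps(1) oct_mult_in_octonions]
    by (simp add: cd_mult_lower)
qed

section \<open>The projection onto the octonions\<close>

lemma linear_proj_oct: "linear proj_oct"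
  by (rule linearI) (auto simp: proj_oct_def scaleR_fun_def fun_eq_iff)

lemma proj_oct_in_octonions [simp]: "proj_oct x \<in> octonions"
  by (simp add: proj_oct_def cd_carrier_def)

lemma proj_oct_id [simp]: "p \<in> octonions \<Longrightarrow> proj_oct p = p"
  by (auto simp: proj_oct_def cd_carrier_def fun_eq_iff)

lemma proj_oct_join [simp]:
  assumes "n \<ge> 3"
  shows "proj_oct (cd_join (Suc n) a b) = proj_oct a"
  using power_increasing[OF assms, of "2::nat"] by (auto simp: proj_oct_def cd_join_def fun_eq_iff)

text \<open>Left multiplication by an octonion respects the two halves of a pair, and the projection
  sees only the first, so the claim descends level by level to the octonions.\<close>

lemma proj_oct_mult:
  assumes "n \<ge> 3" "p \<in> octonions" "x \<in> cd_carrier n"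
  shows "proj_oct (cd_mult n p x) = oct_mult p (proj_oct x)"
  using assms
proof (induction n arbitrary: x rule: dec_induct)
  case base
  then show ?case by (simp add: cd_mult_3 oct_mult_in_octonions)
next
  case (step n)
  obtain a b where "a \<in> cd_carrier n" "b \<in> cd_carrier n" "x = cd_join (Suc n) a b"
    using step.prems(2) by (rule cd_carrier_SucE)
  then show ?case
    using step octonions_subset[of n p] by (simp add: cd_mult_lower)
qed

lemma proj_oct_conj:
  assumes "n \<ge> 3" "x \<in> cd_carrier n"
  shows "proj_oct (cd_conj n x) = oct_conj (proj_oct x)"
  using assms by (auto simp: cd_conj_apply oct_conj_apply proj_oct_def fun_eq_iff)


section \<open>The basis\<close>

lemma cd_basis_in_carrier: "i < 2 ^ n \<Longrightarrow> cd_basis i \<in> cd_carrier n"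
  by (auto simp: cd_basis_def cd_carrier_def)

lemma cd_basis_upper: "i < 2 ^ n \<Longrightarrow> cd_basis (2 ^ n + i) = cd_join (Suc n) 0 (cd_basis i)"
  by (auto simp: cd_basis_def cd_join_def fun_eq_iff)

lemma cd_conj_basis:
  assumes "n \<ge> 3" "i < 2 ^ n"
  shows "cd_conj n (cd_basis i) = (if i = 0 then cd_basis i else - cd_basis i)"
  using assms cd_basis_in_carrier[of i n] by (auto simp: cd_conj_apply cd_basis_def fun_eq_iff)

lemma eight_times_power: "n \<ge> 3 \<Longrightarrow> 8 * 2 ^ (n - 3) = (2::nat) ^ n"
  using power_add[of "2::nat" 3 "n - 3"] by simp

text \<open>The first component is expanded directly. The second needs coefficients to the right of
  the basis vectors, because p (0, e) = (0, e p); these come from conjugating an expansion of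
  b*.\<close>

lemma cd_basis_spans:
  assumes "n \<ge> 3" "x \<in> cd_carrier n"
  shows "\<exists>p. (\<forall>k. p k \<in> octonions) \<and> x = (\<Sum>k<2 ^ (n - 3). cd_mult n (p k) (cd_basis (8 * k)))"
  using assms
proof (induction n arbitrary: x rule: dec_induct)
  case base
  then show ?case
    using oct_mult_e0(2)[of x] by (intro exI[of _ "\<lambda>_. x"]) (simp add: cd_mult_3)
next
  case (step n)
  \<comment> \<open>\<open>m\<close> counts the vectors \<open>cd_basis (8 * k)\<close> at level
    \<open>n\<close>. The next level has \<open>m + m\<close> of them, and index
    \<open>8 * (m + k)\<close> is \<open>2 ^ n + 8 * k\<close>, in the upper half.\<close>
  define m where "m = (2::nat) ^ (n - 3)"
  have m: "8 * m = 2 ^ n" "2 ^ (Suc n - 3) = m + m"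
    using step.hyps by (simp_all only: m_def eight_times_power Suc_diff_le power_Suc mult_2)
  have e: "cd_basis (8 * k) \<in> cd_carrier n" if "k < m" for k
    using that m by (intro cd_basis_in_carrier) simp
  obtain a b where x: "a \<in> cd_carrier n" "b \<in> cd_carrier n" "x = cd_join (Suc n) a b"
    using step.prems by (rule cd_carrier_SucE)
  obtain p where p: "\<And>k. p k \<in> octonions" and a: "a = (\<Sum>k<m. cd_mult n (p k) (cd_basis (8 * k)))"
    using step.IH[OF x(1)] unfolding m_def by auto
  obtain q where q: "\<And>k. q k \<in> octonions"
    and b': "cd_conj n b = (\<Sum>k<m. cd_mult n (q k) (cd_basis (8 * k)))"
    using step.IH[OF cd_conj_in_carrier[OF step.hyps(1)]] unfolding m_def by blast
  \<comment> \<open>Conjugating q e gives e* q*. Since e* = -e except for the unit, the sign is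
    moved into the coefficient.\<close>
  define r where "r k = (if k = 0 then cd_conj n (q k) else - cd_conj n (q k))" for k
  have r: "r k \<in> octonions" for k
    using q step.hyps by (simp add: r_def)
  have pr: "p k \<in> cd_carrier n" "q k \<in> cd_carrier n" "r k \<in> cd_carrier n" for k
    by (intro octonions_subset[OF step.hyps(1)] p q r)+
  have "b = cd_conj n (\<Sum>k<m. cd_mult n (q k) (cd_basis (8 * k)))"
    using x step.hyps by (simp add: cd_conj_conj flip: b')
  also have "\<dots> = (\<Sum>k<m. cd_conj n (cd_mult n (q k) (cd_basis (8 * k))))"
    by (rule linear_sum[OF linear_cd_conj])
  also have "\<dots> = (\<Sum>k<m. cd_mult n (cd_basis (8 * k)) (r k))"
    using e pr step.hyps m
    by (intro sum.cong) (auto simp: cd_conj_mult cd_conj_basis r_def cd_mult_linear)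
  finally have b: "b = (\<Sum>k<m. cd_mult n (cd_basis (8 * k)) (r k))" .
  define s where "s k = (if k < m then p k else r (k - m))" for k
  have lower: "linear (\<lambda>y. cd_join (Suc n) y 0)" and upper: "linear (cd_join (Suc n) 0)"
    by (intro linear_cd_join linear_ident linear_zero)+
  have "x = cd_join (Suc n) a 0 + cd_join (Suc n) 0 b"
    by (simp add: x(3) cd_join_add)
  also have "cd_join (Suc n) a 0 = (\<Sum>k<m. cd_mult (Suc n) (s k) (cd_basis (8 * k)))"
    unfolding a linear_sum[OF lower]
  proof (intro sum.cong refl)
    fix k assume "k \<in> {..<m}"
    then show "cd_join (Suc n) (cd_mult n (p k) (cd_basis (8 * k))) 0
        = cd_mult (Suc n) (s k) (cd_basis (8 * k))"
      using cd_mult_lower[OF step.hyps(1) pr(1)[of k] e[of k], of 0] e[of k]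
      by (simp add: s_def cd_join_right_zero)
  qed
  also have "cd_join (Suc n) 0 b = (\<Sum>k<m. cd_mult (Suc n) (s (m + k)) (cd_basis (8 * (m + k))))"
    unfolding b linear_sum[OF upper]
  proof (intro sum.cong refl)
    fix k assume "k \<in> {..<m}"
    then show "cd_join (Suc n) 0 (cd_mult n (cd_basis (8 * k)) (r k))
        = cd_mult (Suc n) (s (m + k)) (cd_basis (8 * (m + k)))"
      using cd_mult_lower[OF step.hyps(1) pr(3)[of k] _ e[of k], of 0] e[of k]
        cd_basis_upper[of "8 * k" n] m
      by (simp add: s_def distrib_left)
  qed
  finally have "x = (\<Sum>k<m + m. cd_mult (Suc n) (s k) (cd_basis (8 * k)))"
    unfolding sum_lessThan_add .
  moreover have "\<forall>k. s k \<in> octonions"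
    using p r by (simp add: s_def)
  ultimately show ?case
    unfolding m by blast
qed

text \<open>This one computation serves three purposes: p = \<open>cd_basis 0\<close> gives
  orthonormality, general p gives weak associativity, and linearity then extracts the coefficients
  of an expansion. The induction leaves p arbitrary because it is also used at p*.\<close>

lemma cd_basis_coefficient:
  assumes "n \<ge> 3" "p \<in> octonions" "i < 2 ^ (n - 3)" "k < 2 ^ (n - 3)"
  shows "proj_oct (cd_mult n (cd_mult n p (cd_basis (8 * i))) (cd_conj n (cd_basis (8 * k))))
    = (if i = k then p else 0)"
  using assms
proof (induction n arbitrary: p i k rule: dec_induct)
  case base
  then show ?case by (simp add: cd_mult_3 oct_mult_e0)
next
  case (step n)
  define m where "m = (2::nat) ^ (n - 3)"
  have m: "8 * m = 2 ^ n" "2 ^ (Suc n - 3) = m + m"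
    using step.hyps by (simp_all only: m_def eight_times_power Suc_diff_le power_Suc mult_2)
  have e: "cd_basis (8 * k) \<in> cd_carrier n" if "k < m" for k
    using that m by (intro cd_basis_in_carrier) simp
  note p = octonions_subset[OF step.hyps(1) step.prems(1)]
  have low: "cd_basis (8 * k) = cd_join (Suc n) (cd_basis (8 * k)) 0" if "k < m" for k
    using e[OF that] by (simp add: cd_join_right_zero)
  have up: "cd_basis (8 * (m + k)) = cd_join (Suc n) 0 (cd_basis (8 * k))" if "k < m" for k
    using that m cd_basis_upper[of "8 * k" n] by (simp add: distrib_left)
  have split: "j < m \<or> (\<exists>l<m. j = m + l)" if "j < m + m" for j
    using that by presburger
  have mult_low: "cd_mult (Suc n) p (cd_basis (8 * k))
      = cd_join (Suc n) (cd_mult n p (cd_basis (8 * k))) 0"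
    and conj_low: "cd_conj (Suc n) (cd_basis (8 * k)) = cd_join (Suc n) (cd_conj n (cd_basis (8 * k))) 0"
    if "k < m" for k
    using low[OF that] e[OF that] p step.hyps cd_mult_lower[of n p "cd_basis (8 * k)" 0]
      cd_conj_join[of n "cd_basis (8 * k)" 0] by simp_all
  have mult_up: "cd_mult (Suc n) p (cd_basis (8 * (m + k)))
      = cd_join (Suc n) 0 (cd_mult n (cd_basis (8 * k)) p)"
    and conj_up: "cd_conj (Suc n) (cd_basis (8 * (m + k))) = cd_join (Suc n) 0 (- cd_basis (8 * k))"
    if "k < m" for k
    using up[OF that] e[OF that] p step.hyps cd_mult_lower[of n p 0 "cd_basis (8 * k)"]
      cd_conj_join[of n 0 "cd_basis (8 * k)"] by simp_all
  note simps = mult_low mult_up conj_low conj_up cd_mult_join p e step.hyps cd_conj_linear cd_mult_linear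
  consider "i < m" "k < m" | l where "i < m" "l < m" "k = m + l" | j where "j < m" "i = m + j" "k < m"
    | j l where "j < m" "i = m + j" "l < m" "k = m + l"
    using split[of i] split[of k] step.prems(2,3) unfolding m by blast
  then show ?case
  proof cases
    case 1
    then show ?thesis
      using step.IH[of p i k] step.prems(1) by (simp add: simps m_def[symmetric])
  next
    case 2
    \<comment> \<open>Here and in the next case one factor lies in the lower half and the other in
      the upper, so the product lies in the upper half and projects to 0. The index
      \<open>8 * (m + l)\<close> must stay factored for \<open>mult_up\<close> and
      \<open>conj_up\<close> to match.\<close>
    then show ?thesis
      by (simp add: simps linear_0[OF linear_proj_oct] del: distrib_left_numeral)
  next
    case 3
    then show ?thesis
      by (simp add: simps linear_0[OF linear_proj_oct] del: distrib_left_numeral)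
  next
    case 4
    let ?p = "cd_conj n p"
    have "proj_oct (cd_mult n (cd_conj n (cd_basis (8 * l))) (cd_mult n (cd_basis (8 * j)) p))
        = oct_conj (proj_oct (cd_mult n (cd_mult n ?p (cd_conj n (cd_basis (8 * j)))) (cd_basis (8 * l))))"
      using 4 by (simp add: cd_conj_mult cd_conj_conj simps flip: proj_oct_conj[of n])
    also have "proj_oct (cd_mult n (cd_mult n ?p (cd_conj n (cd_basis (8 * j)))) (cd_basis (8 * l)))
        = (if j = l then ?p else 0)"
      using step.IH[of ?p j l] 4 step.prems(1) step.hyps m
      by (auto simp: cd_conj_basis cd_mult_linear linear_neg[OF linear_proj_oct] m_def[symmetric]
          split: if_splits)
    also have "oct_conj \<dots> = (if j = l then p else 0)"
      using proj_oct_conj[of n ?p] step.prems(1) step.hyps p by (simp add: cd_conj_conj)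
    finally show ?thesis
      using 4 by (simp add: simps del: distrib_left_numeral)
  qed
qed


section \<open>The Hilbert module\<close>

lemma linear_cd_inner_left: "linear (\<lambda>u. cd_inner n u v)"
  unfolding cd_inner_def
  using linear_compose[OF linear_cd_mult_left linear_proj_oct] by (simp add: o_def)

lemma linear_cd_inner_right: "linear (cd_inner n u)"
proof -
  have "linear (\<lambda>v. proj_oct (cd_mult n u (cd_conj n v)))"
    using linear_compose[OF linear_compose[OF linear_cd_conj linear_cd_mult_right] linear_proj_oct]
    by (simp add: o_def)
  then show ?thesis
    by (simp add: cd_inner_def[abs_def])
qed

lemma cd_inner_self:
  assumes "n \<ge> 3" "u \<in> cd_carrier n"
  shows "cd_inner n u u = (\<Sum>i<2 ^ n. (u i)\<^sup>2) *\<^sub>R cd_basis 0"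
proof -
  have "(\<Sum>i<2 ^ n. (u i)\<^sup>2) *\<^sub>R cd_basis 0 \<in> octonions"
    by (simp add: cd_basis_in_carrier)
  then show ?thesis
    using assms by (simp add: cd_inner_def cd_mult_self_conj)
qed

lemma cd_inner_commute:
  assumes "n \<ge> 3" "u \<in> cd_carrier n" "v \<in> cd_carrier n"
  shows "cd_inner n u v = oct_conj (cd_inner n v u)"
  using assms by (simp add: cd_inner_def cd_conj_mult cd_conj_conj flip: proj_oct_conj[of n])

lemma oct_Re_eq: "x \<in> octonions \<Longrightarrow> oct_Re x = x 0 *\<^sub>R cd_basis 0"
  by (auto simp: oct_Re_def oct_conj_apply cd_basis_def scaleR_fun_def cd_carrier_def fun_eq_iff)

lemma cd_inner_para_linear:
  assumes "n \<ge> 3" "p \<in> octonions" "u \<in> cd_carrier n" "v \<in> cd_carrier n"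
  shows "oct_Re (cd_inner n (cd_mult n p u) v - oct_mult p (cd_inner n u v)) = 0"
proof -
  have p: "p \<in> cd_carrier n"
    using assms(1,2) by (rule octonions_subset)
  have "cd_inner n (cd_mult n p u) v 0 = cd_mult n (cd_mult n p u) (cd_conj n v) 0"
    by (simp add: cd_inner_def proj_oct_def)
  also have "\<dots> = cd_mult n p (cd_mult n u (cd_conj n v)) 0"
    using assms p by (intro cd_Re_assoc) auto
  also have "\<dots> = oct_mult p (cd_inner n u v) 0"
    using assms fun_cong[OF proj_oct_mult[of n p "cd_mult n u (cd_conj n v)"], of 0]
    by (simp add: cd_inner_def) (simp add: proj_oct_def)
  finally show ?thesis
    by (subst oct_Re_eq) (simp_all add: cd_inner_def oct_mult_in_octonions)
qed

lemma oct_norm_cd_inner: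
  assumes "n \<ge> 3" "u \<in> cd_carrier n"
  shows "oct_norm (cd_inner n) u = sqrt (\<Sum>i<2 ^ n. (u i)\<^sup>2)"
  using assms by (simp add: oct_norm_def cd_inner_self scaleR_fun_def cd_basis_def)

text \<open>The norm is the Euclidean one by \<open>oct_norm_cd_inner\<close>. It dominates every
  coordinate, so coordinate sequences are Cauchy; the coordinatewise limits give norm convergence
  because only finitely many coordinates matter.\<close>

lemma cd_inner_complete:
  assumes n: "n \<ge> 3" and \<sigma>: "\<And>k. \<sigma> k \<in> cd_carrier n"
    and cauchy: "\<And>\<epsilon>. \<epsilon> > 0 \<Longrightarrow> \<exists>N::nat. \<forall>j\<ge>N. \<forall>k\<ge>N. oct_norm (cd_inner n) (\<sigma> j - \<sigma> k) < \<epsilon>"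
  shows "\<exists>l\<in>cd_carrier n. (\<lambda>k. oct_norm (cd_inner n) (\<sigma> k - l)) \<longlonglongrightarrow> 0"
proof -
  have coord: "\<bar>u i\<bar> \<le> oct_norm (cd_inner n) u" if "u \<in> cd_carrier n" "i < 2 ^ n" for u i
  proof -
    have "(u i)\<^sup>2 \<le> (\<Sum>i<2 ^ n. (u i)\<^sup>2)"
      using that by (intro member_le_sum) auto
    then have "sqrt ((u i)\<^sup>2) \<le> sqrt (\<Sum>i<2 ^ n. (u i)\<^sup>2)"
      by (rule real_sqrt_le_mono)
    then show ?thesis
      using that n by (simp add: oct_norm_cd_inner)
  qed
  have "Cauchy (\<lambda>k. \<sigma> k i)" if "i < 2 ^ n" for i
  proof (rule metric_CauchyI)
    fix \<epsilon> :: real assume "\<epsilon> > 0"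
    then obtain N where N: "\<And>j k. j \<ge> N \<Longrightarrow> k \<ge> N \<Longrightarrow> oct_norm (cd_inner n) (\<sigma> j - \<sigma> k) < \<epsilon>"
      using cauchy by meson
    have "dist (\<sigma> j i) (\<sigma> k i) < \<epsilon>" if "j \<ge> N" "k \<ge> N" for j k
      using coord[of "\<sigma> j - \<sigma> k" i] N[OF that] \<sigma> \<open>i < 2 ^ n\<close> by (simp add: dist_real_def)
    then show "\<exists>M. \<forall>j\<ge>M. \<forall>k\<ge>M. dist (\<sigma> j i) (\<sigma> k i) < \<epsilon>" by blast
  qed
  then have conv: "(\<lambda>k. \<sigma> k i) \<longlonglongrightarrow> lim (\<lambda>k. \<sigma> k i)" if "i < 2 ^ n" for i
    using that Cauchy_convergent convergent_LIMSEQ_iff by blast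
  define l where "l i = (if i < 2 ^ n then lim (\<lambda>k. \<sigma> k i) else 0)" for i
  have l: "l \<in> cd_carrier n"
    by (simp add: l_def cd_carrier_def)
  have "(\<lambda>k. sqrt (\<Sum>i<2 ^ n. (\<sigma> k i - l i)\<^sup>2)) \<longlonglongrightarrow> sqrt (\<Sum>i<2 ^ n. (l i - l i)\<^sup>2)"
    by (intro tendsto_intros) (simp add: l_def conv)
  then have "(\<lambda>k. oct_norm (cd_inner n) (\<sigma> k - l)) \<longlonglongrightarrow> 0"
    using n \<sigma> l by (simp add: oct_norm_cd_inner)
  with l show ?thesis by blast
qed

lemma hilbert_left_oct_module_cd:
  assumes n: "n \<ge> 3"
  shows "hilbert_left_oct_module (cd_carrier n) (cd_mult n) (cd_inner n)"
proof unfold_locales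
  show "cd_mult n p x \<in> cd_carrier n" for p x
    using n by simp
  show "cd_mult n p (cd_mult n p x) = cd_mult n (oct_mult p p) x"
    if "p \<in> octonions" "x \<in> cd_carrier n" for p x
    using n that by (rule cd_left_alternative)
  show "\<exists>r\<ge>0. cd_inner n u u = r *\<^sub>R cd_basis 0" if "u \<in> cd_carrier n" for u
    using cd_inner_self[OF n that] sum_nonneg[of "{..<2 ^ n}" "\<lambda>i. (u i)\<^sup>2"]
    by (intro exI[of _ "\<Sum>i<2 ^ n. (u i)\<^sup>2"]) simp
  show "cd_inner n u u = 0 \<longleftrightarrow> u = 0" if "u \<in> cd_carrier n" for u
  proof
    assume "cd_inner n u u = 0"
    then have "(\<Sum>i<2 ^ n. (u i)\<^sup>2) = 0"
      using fun_cong[OF cd_inner_self[OF n that], of 0] by (simp add: scaleR_fun_def cd_basis_def)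
    then have coords: "u i = 0" if "i < 2 ^ n" for i
      using that by (simp add: sum_nonneg_eq_0_iff)
    show "u = 0"
    proof
      show "u i = 0 i" for i
        using that coords[of i] by (cases "i < 2 ^ n") (simp_all add: cd_carrier_def)
    qed
  qed (simp add: linear_0[OF linear_cd_inner_left])
  show "\<exists>l\<in>cd_carrier n. (\<lambda>k. oct_norm (cd_inner n) (\<sigma> k - l)) \<longlonglongrightarrow> 0"
    if "\<And>k. \<sigma> k \<in> cd_carrier n"
      "\<And>\<epsilon>. \<epsilon> > 0 \<Longrightarrow> \<exists>N::nat. \<forall>j\<ge>N. \<forall>k\<ge>N. oct_norm (cd_inner n) (\<sigma> j - \<sigma> k) < \<epsilon>" for \<sigma>
    using n that by (rule cd_inner_complete)
  show "cd_inner n u v \<in> octonions" for u v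
    by (simp add: cd_inner_def)
  show "cd_inner n u v = oct_conj (cd_inner n v u)" if "u \<in> cd_carrier n" "v \<in> cd_carrier n" for u v
    using n that by (rule cd_inner_commute)
  show "oct_Re (cd_inner n (cd_mult n p u) v - oct_mult p (cd_inner n u v)) = 0"
    if "p \<in> octonions" "u \<in> cd_carrier n" "v \<in> cd_carrier n" for p u v
    using n that by (rule cd_inner_para_linear)
qed (simp_all add: n subspace_cd_carrier cd_mult_linear cd_mult_e0
      linear_add[OF linear_cd_inner_left] linear_scale[OF linear_cd_inner_left]
      linear_add[OF linear_cd_inner_right] linear_scale[OF linear_cd_inner_right])


section \<open>The weak associative basis\<close>

lemma cd_inner_basis:
  assumes "n \<ge> 3" "i < 2 ^ (n - 3)" "k < 2 ^ (n - 3)"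
  shows "cd_inner n (cd_basis (8 * i)) (cd_basis (8 * k)) = (if i = k then cd_basis 0 else 0)"
proof -
  have "cd_basis (8 * i) \<in> cd_carrier n"
    using assms(2) by (intro cd_basis_in_carrier) (simp add: flip: eight_times_power[OF assms(1)])
  moreover have "cd_basis 0 \<in> octonions"
    by (simp add: cd_basis_in_carrier)
  ultimately show ?thesis
    using cd_basis_coefficient[of n "cd_basis 0" i k] assms by (simp add: cd_inner_def cd_mult_e0)
qed

text \<open>Some octonion coefficients exist by \<open>cd_basis_spans\<close>; pairing with a basis
  vector identifies each of them by \<open>cd_basis_coefficient\<close>.\<close>

lemma cd_expansion:
  assumes "n \<ge> 3" "x \<in> cd_carrier n"
  shows "x = (\<Sum>i<2 ^ (n - 3). cd_mult n (cd_inner n x (cd_basis (8 * i))) (cd_basis (8 * i)))"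
proof -
  obtain p where p: "\<And>k. p k \<in> octonions"
    and x: "x = (\<Sum>k<2 ^ (n - 3). cd_mult n (p k) (cd_basis (8 * k)))"
    using cd_basis_spans[OF assms] by blast
  have "cd_inner n x (cd_basis (8 * i)) = p i" if i: "i < 2 ^ (n - 3)" for i
  proof -
    have "cd_inner n x (cd_basis (8 * i))
        = (\<Sum>k<2 ^ (n - 3). cd_inner n (cd_mult n (p k) (cd_basis (8 * k))) (cd_basis (8 * i)))"
      unfolding x by (rule linear_sum[OF linear_cd_inner_left])
    also have "\<dots> = (\<Sum>k<2 ^ (n - 3). if k = i then p k else 0)"
      unfolding cd_inner_def using assms(1) p i by (intro sum.cong) (simp_all add: cd_basis_coefficient)
    finally show ?thesis
      using i by simp
  qed
  then show ?thesis
    by (subst x) (intro sum.cong, simp_all)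
qed

lemma weak_associative_basis_cd:
  assumes n: "n \<ge> 3"
  shows "weak_associative_basis (cd_carrier n) (cd_mult n) (cd_inner n)
    ((\<lambda>i. cd_basis (8 * i)) ` {..<2 ^ (n - 3)})" (is "weak_associative_basis _ _ _ ?S")
proof -
  have inj: "cd_basis i = cd_basis j \<longleftrightarrow> i = j" for i j
    by (auto simp: cd_basis_def fun_eq_iff split: if_splits)
  have e0: "cd_basis 0 \<in> octonions" "cd_basis 0 \<noteq> 0"
    by (simp_all add: cd_basis_in_carrier) (auto simp: cd_basis_def fun_eq_iff)
  have "cd_basis (8 * i) \<in> cd_carrier n" if "i < 2 ^ (n - 3)" for i
    using that by (intro cd_basis_in_carrier) (simp add: flip: eight_times_power[OF n])
  then have orth: "orthonormal_system (cd_carrier n) (cd_inner n) ?S"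
    using n by (auto simp: orthonormal_system_def cd_inner_basis inj)
  \<comment> \<open>Maximality: an extra member y of T is orthogonal to all of the set, hence 0 by
    its expansion, contradicting that its inner product with itself is
    \<open>cd_basis 0\<close>.\<close>
  have "\<not> ?S \<subset> T" if T: "orthonormal_system (cd_carrier n) (cd_inner n) T" for T
  proof
    assume "?S \<subset> T"
    then obtain y where y: "y \<in> T" "y \<notin> ?S" and "?S \<subseteq> T" by blast
    have "cd_inner n y (cd_basis (8 * i)) = 0" if "i < 2 ^ (n - 3)" for i
    proof -
      have "cd_basis (8 * i) \<in> T" "y \<noteq> cd_basis (8 * i)"
        using that y \<open>?S \<subseteq> T\<close> by blast+
      then show ?thesis
        using T y(1) unfolding orthonormal_system_def by simp
    qed
    then have "(\<Sum>i<2 ^ (n - 3). cd_mult n (cd_inner n y (cd_basis (8 * i))) (cd_basis (8 * i))) = 0"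
      by simp
    then have "y = 0"
      using cd_expansion[OF n, of y] T y(1) unfolding orthonormal_system_def by (metis subsetD)
    then have "cd_inner n y y = 0"
      by (simp add: linear_0[OF linear_cd_inner_left])
    then show False
      using T y e0 unfolding orthonormal_system_def by simp
  qed
  moreover have "second_assoc (cd_mult n) (cd_inner n) p x y = 0"
    if "p \<in> octonions" "x \<in> ?S" "y \<in> ?S" for p x y
  proof -
    from that obtain i k where ik: "i < 2 ^ (n - 3)" "k < 2 ^ (n - 3)"
      and xy: "x = cd_basis (8 * i)" "y = cd_basis (8 * k)"
      by blast
    \<comment> \<open>Both terms of the second associator equal p on the diagonal and 0 off
      it.\<close>
    have "cd_inner n (cd_mult n p x) y = (if i = k then p else 0)"
      using cd_basis_coefficient[OF n that(1) ik] by (simp add: cd_inner_def xy)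
    then show ?thesis
      using cd_inner_basis[OF n ik] that(1) by (simp add: second_assoc_def xy oct_mult_e0)
  qed
  ultimately show ?thesis
    using orth unfolding weak_associative_basis_def orthonormal_basis_def by blast
qed

theorem mainTheorem7:
  fixes n :: nat
  assumes "n \<ge> 4"
  shows "hilbert_left_oct_module (cd_carrier n) (cd_mult n) (cd_inner n) \<and>
    weak_associative_basis (cd_carrier n) (cd_mult n) (cd_inner n)
      {cd_basis (8 * i) | i. i \<in> {0..2 ^ (n - 3) - 1}} \<and>
    (\<forall>x \<in> cd_carrier n.
       x = (\<Sum>i = 0..2 ^ (n - 3) - 1.
              cd_mult n (proj_oct (cd_mult n x (cd_conj n (cd_basis (8 * i))))) (cd_basis (8 * i))))"
proof -
  have n: "n \<ge> 3"
    using assms by simp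
  \<comment> \<open>Positivity ensures that the natural subtraction in the upper bound
    \<open>2 ^ (n - 3) - 1\<close> does not truncate.\<close>
  have "(0::nat) < 2 ^ (n - 3)"
    by simp
  then have ivl: "{0..2 ^ (n - 3) - 1} = {..<(2::nat) ^ (n - 3)}"
    by (intro set_eqI, unfold atLeastAtMost_iff lessThan_iff) arith
  have S: "{cd_basis (8 * i) | i. i \<in> {..<2 ^ (n - 3)}} = (\<lambda>i. cd_basis (8 * i)) ` {..<2 ^ (n - 3)}"
    by blast
  show ?thesis
    unfolding ivl S
    using hilbert_left_oct_module_cd[OF n] weak_associative_basis_cd[OF n]
      cd_expansion[OF n, unfolded cd_inner_def]
    by blast
qed

end
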